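(* There is $\lambda_0>0$ such that for every $\lambda\in(0,\lambda_0]$ the following holds. For any $a\in(\frac12,1)$ there is a constant $c$ such that for every integer $\ell\ge 3$ and every $m_\Delta=\underline m=(m_1,\dots,m_\ell)$ with $m_i\in\mathcal M_\ell$, $|m_i|\le m_+$, $i=1,\dots,\ell$, calling $\underline h=(h_1,\dots,h_\ell)$ the magnetic fields associated to $\underline m$, $$\Big|\frac1{\ell^2}\log\big\{e^{-\ell\sum_ih_im_i}Z_{\Delta,\underline h}\big\}+\phi_\ell(m_\Delta)\Big|\le c\,\ell^{a-1}.$$
   Context: $\Delta=\{1,\dots,\ell\}^2$ with points $(x,i)$, $|\Delta|=\ell^2$; $\mathcal M_\ell=\{-1,-1+\frac2\ell,\dots,1-\frac2\ell,1\}$. For $\sigma\in\{-1,1\}^\Delta$, $H^{\rm vert}_\ell(\sigma)=-\lambda\sum_{x=1}^\ell\sum_{i=1}^\ell\sigma(x,i)\sigma(x,i+1)$ with $\sigma(x,\ell+1)=\sigma(x,1)$. Define $$Z_{\Delta,\underline h}=\sum_{\sigma\in\{-1,1\}^\Delta}e^{-H^{\rm vert}_\ell(\sigma)+\sum_{(x,i)\in\Delta}h_i\sigma(x,i)},$$ $$\phi_\ell(m_\Delta)=-\frac1{|\Delta|}\log\sum_{\sigma\in\{-1,1\}^\Delta}e^{-H^{\rm vert}_\ell(\sigma)}\,\mathbf 1_{\{\sum_x\sigma(x,i)=\ell m_i\ \text{for all } i\}} .$$ Let $Z_{\ell,\underline h}=\sum_{\sigma\in\{-1,1\}^{\{1,\dots,\ell\}}}e^{\sum_{i=1}^\ell\{\lambda\sigma(i)\sigma(i+1)+h_i\sigma(i)\}}$,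 $\sigma(\ell+1)=\sigma(1)$ (so $Z_{\Delta,\underline h}=Z_{\ell,\underline h}^{\,\ell}$). The magnetic fields $\underline h$ associated to $\underline m$ are the unique solution of $m_i=\frac{\partial}{\partial h_i}\log Z_{\ell,\underline h}$, $i=1,\dots,\ell$ (for $\lambda$ small enough existence and uniqueness hold for all $\underline m$ with $|m_i|\le m_+$). $m_+$ is a fixed constant, independent of $\lambda$ and $\ell$, with $m^*<m_+<1$; here $m^*\in(0,1)$ is defined by $\operatorname{arctanh}(m^* )-m^*=h^*$, and $h^*>3$ by $\frac{3}{\cosh^2(h^*-3)}=\frac14$. *)

theory Defs
  imports Complex_Main "HOL-Library.FuncSet"
begin

definition square :: "nat \<Rightarrow> (nat \<times> nat) set" where
  "square l = {1..l} \<times> {1..l}"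

text \<open>Configurations are extensional functions, so that for a finite \<open>A\<close> there are exactly
  \<open>2 ^ card A\<close> of them and sums over configurations count each one once.\<close>

definition configs :: "'a set \<Rightarrow> ('a \<Rightarrow> real) set" where
  "configs A = A \<rightarrow>\<^sub>E {-1, 1}"

definition magnetizations :: "nat \<Rightarrow> real set" where
  "magnetizations l = {-1 + 2 * real k / real l | k. k \<le> l}"

text \<open>Periodic boundary conditions: the successor of \<open>l\<close> in \<open>{1..l}\<close> is \<open>1\<close>.\<close>

definition next_site :: "nat \<Rightarrow> nat \<Rightarrow> nat" where
  "next_site l i = (if i = l then 1 else i + 1)"

definition H_vert :: "real \<Rightarrow> nat \<Rightarrow> (nat \<times> nat \<Rightarrow> real) \<Rightarrow> real" where
  "H_vert lam l \<sigma> = - lam * (\<Sum>x = 1..l. \<Sum>i = 1..l. \<sigma> (x, i) * \<sigma> (x, next_site l i))"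

definition Z_square :: "real \<Rightarrow> nat \<Rightarrow> (nat \<Rightarrow> real) \<Rightarrow> real" where
  "Z_square lam l h =
     (\<Sum>\<sigma>\<in>configs (square l). exp (- H_vert lam l \<sigma> + (\<Sum>(x, i)\<in>square l. h i * \<sigma> (x, i))))"

definition phi :: "real \<Rightarrow> nat \<Rightarrow> (nat \<Rightarrow> real) \<Rightarrow> real" where
  "phi lam l m =
     - (1 / real (card (square l))) *
       ln (\<Sum>\<sigma>\<in>configs (square l). exp (- H_vert lam l \<sigma>) *
             of_bool (\<forall>i\<in>{1..l}. (\<Sum>x = 1..l. \<sigma> (x, i)) = real l * m i))"

definition Z_column :: "real \<Rightarrow> nat \<Rightarrow> (nat \<Rightarrow> real) \<Rightarrow> real" where
  "Z_column lam l h =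
     (\<Sum>\<sigma>\<in>configs {1..l}. exp (\<Sum>i = 1..l. lam * \<sigma> i * \<sigma> (next_site l i) + h i * \<sigma> i))"

text \<open>The fields \<open>h\<close> solve \<open>m\<^sub>i = \<partial> ln Z / \<partial> h\<^sub>i\<close> for \<open>i = 1, \<dots>, l\<close>. A field
  vector \<open>(h\<^sub>1, \<dots>, h\<^sub>l)\<close> is represented by an extensional function on \<open>{1..l}\<close>, so that
  uniqueness of the function is uniqueness of the vector.\<close>

definition associated_fields :: "real \<Rightarrow> nat \<Rightarrow> (nat \<Rightarrow> real) \<Rightarrow> (nat \<Rightarrow> real) \<Rightarrow> bool" where
  "associated_fields lam l m h \<longleftrightarrow>
     h \<in> extensional {1..l} \<and>
     (\<forall>i\<in>{1..l}. ((\<lambda>t. ln (Z_column lam l (h(i := t)))) has_real_derivative m i) (at (h i)))"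

end

theory Submission
  imports Defs "HOL-Analysis.Analysis"
begin

text \<open>Weighting configurations with the fields \<open>h\<close> makes the columns independent, and the quantity to
  bound is \<open>- ln P / l\<^sup>2\<close>, where \<open>P\<close> is the probability that all row sums equal their means \<open>l * m i\<close>.
  The variances of the \<open>l\<close> row sums add up to at most \<open>l\<^sup>2\<close>, so with probability at least \<open>1/2\<close> the
  errors in the rows add up to \<open>O(l powr (3/2))\<close>, and that many spin flips repair them. A flip costs a bounded
  factor, because the fields are bounded, and the choice of flipped sites costs a factor
  \<open>(l\<^sup>2 + 1) ^ O(l powr (3/2))\<close>; hence \<open>- ln P = O(l powr (3/2) * ln l)\<close>.\<close>

subsection \<open>Columns\<close>

text \<open>The rows are correlated through the interaction inside each column, so a sharp value of
  \<open>P\<close> would call for a joint local limit theorem in \<open>l\<close> dimensions. The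
  claim leaves much room, since \<open>- ln P\<close> may be of order \<open>l powr (1 + a)\<close>;
  a crude lower bound on \<open>P\<close> resting on independence of the columns alone is enough,
  whatever the correlations along a column. The exponent 3/2 comes from Cauchy-Schwarz over the
  \<open>l\<close> rows, which turns squared errors of total \<open>O(l\<^sup>2)\<close> into
  absolute errors of total \<open>O(l powr (3/2))\<close>. The logarithm is absorbed into
  \<open>l powr (a - 1/2)\<close>, which is where \<open>a > 1/2\<close> enters. In the other
  direction \<open>P \<le> 1\<close> suffices. The fields are bounded uniformly in \<open>l\<close>
  because \<open>\<bar>m i\<bar> \<le> m_plus < 1\<close>: a strong field would force the mean too
  close to 1 or -1.\<close>

lemma finite_configs: "finite A \<Longrightarrow> finite (configs A)"
  by (auto simp: configs_def intro: finite_PiE)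

lemma configs_apply: "c \<in> configs A \<Longrightarrow> i \<in> A \<Longrightarrow> c i = -1 \<or> c i = 1"
  by (auto simp: configs_def PiE_iff)

lemma configs_square: "c \<in> configs A \<Longrightarrow> i \<in> A \<Longrightarrow> (c i)\<^sup>2 = 1"
  using configs_apply by fastforce

lemma configs_upd: "c \<in> configs A \<Longrightarrow> i \<in> A \<Longrightarrow> s \<in> {-1, 1} \<Longrightarrow> c(i := s) \<in> configs A"
  unfolding configs_def by (auto simp: PiE_iff extensional_def)

lemma next_site_in: "i \<in> {1..l} \<Longrightarrow> next_site l i \<in> {1..l}"
  by (auto simp: next_site_def)

lemma bij_betw_next_site: "bij_betw (next_site l) {1..l} {1..l}"
proof -
  have inj: "inj_on (next_site l) {1..l}"
    by (auto simp: inj_on_def next_site_def split: if_splits)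
  moreover have "next_site l ` {1..l} \<subseteq> {1..l}"
    using next_site_in by blast
  ultimately show ?thesis
    by (simp add: bij_betw_def endo_inj_surj)
qed

lemma sum_next_site: "(\<Sum>i=1..l. f (next_site l i)) = (\<Sum>i=1..l. f i)"
  by (rule sum.reindex_bij_betw[OF bij_betw_next_site])

definition column_weight :: "real \<Rightarrow> nat \<Rightarrow> (nat \<Rightarrow> real) \<Rightarrow> (nat \<Rightarrow> real) \<Rightarrow> real" where
  "column_weight lam l h c = exp (\<Sum>i = 1..l. lam * c i * c (next_site l i) + h i * c i)"

lemma column_weight_pos: "column_weight lam l h c > 0"
  by (simp add: column_weight_def)

lemma Z_column_eq: "Z_column lam l h = (\<Sum>c\<in>configs {1..l}. column_weight lam l h c)"
  by (simp add: Z_column_def column_weight_def)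

lemma configs_nonempty: "configs A \<noteq> {}"
  by (auto simp: configs_def PiE_eq_empty_iff)

lemma Z_column_pos: "Z_column lam l h > 0"
  unfolding Z_column_eq by (intro sum_pos finite_configs configs_nonempty column_weight_pos) auto

text \<open>Changing one field is an exponential tilt in that coordinate, so the dependence on
  \<open>t\<close> sits in a single factor and derivatives in \<open>t\<close> can be read
  off.\<close>

lemma column_weight_upd:
  assumes "i \<in> {1..l}"
  shows "column_weight lam l (h(i := t)) c = column_weight lam l h c * exp ((t - h i) * c i)"
proof -
  have "(\<Sum>j = 1..l. lam * c j * c (next_site l j) + (h(i := t)) j * c j) =
     (\<Sum>j = 1..l. lam * c j * c (next_site l j) + h j * c j) + (\<Sum>j = 1..l. if j = i then (t - h i) * c i else 0)"
    unfolding sum.distrib[symmetric] by (intro sum.cong) (auto simp: algebra_simps)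
  also have "(\<Sum>j = 1..l. if j = i then (t - h i) * c i else 0) = (t - h i) * c i"
    using assms by simp
  finally show ?thesis by (simp add: column_weight_def exp_add)
qed

lemma ln_Z_column_deriv:
  assumes "i \<in> {1..l}"
  shows "((\<lambda>t. ln (Z_column lam l (h(i := t)))) has_real_derivative
    (\<Sum>c\<in>configs {1..l}. c i * column_weight lam l h c) / Z_column lam l h) (at (h i))"
proof -
  have "((\<lambda>t. Z_column lam l (h(i := t))) has_real_derivative
     (\<Sum>c\<in>configs {1..l}. c i * column_weight lam l h c)) (at (h i))"
    unfolding Z_column_eq column_weight_upd[OF assms]
    by (auto intro!: derivative_eq_intros simp: algebra_simps)
  from DERIV_chain2[OF DERIV_ln this] show ?thesis
    using Z_column_pos by (simp add: divide_inverse mult.commute)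
qed

text \<open>The derivative of \<open>ln Z\<close> is the Gibbs mean of \<open>c i\<close>.
  Multiplying out \<open>Z\<close> turns the defining equation into a centring condition, the form
  in which a critical point yields it and in which the field bound and the variance estimate use
  it.\<close>

lemma associated_fields_iff:
  "associated_fields lam l m h \<longleftrightarrow> h \<in> extensional {1..l} \<and>
     (\<forall>i\<in>{1..l}. (\<Sum>c\<in>configs {1..l}. (c i - m i) * column_weight lam l h c) = 0)"
proof -
  have "((\<lambda>t. ln (Z_column lam l (h(i := t)))) has_real_derivative m i) (at (h i)) \<longleftrightarrow>
      (\<Sum>c\<in>configs {1..l}. (c i - m i) * column_weight lam l h c) = 0"
    if "i \<in> {1..l}" for i
  proof -
    have "((\<lambda>t. ln (Z_column lam l (h(i := t)))) has_real_derivative m i) (at (h i)) \<longleftrightarrow>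
      (\<Sum>c\<in>configs {1..l}. c i * column_weight lam l h c) / Z_column lam l h = m i"
      (is "?D \<longleftrightarrow> ?L = m i")
    proof
      assume ?D
      then show "?L = m i" by (rule DERIV_unique[OF ln_Z_column_deriv[OF that]])
    next
      assume "?L = m i"
      then show ?D using ln_Z_column_deriv[OF that, of lam h] by (simp only:)
    qed
    also have "\<dots> \<longleftrightarrow> (\<Sum>c\<in>configs {1..l}. c i * column_weight lam l h c) - m i * Z_column lam l h = 0"
      using Z_column_pos[of lam l h] by (simp add: field_simps)
    finally show ?thesis
      by (simp add: Z_column_eq sum_distrib_left sum_subtractf left_diff_distrib)
  qed
  then show ?thesis by (auto simp: associated_fields_def)
qed

subsection \<open>Existence and uniqueness of the fields\<close>

text \<open>The symmetrised relative entropy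
  \<open>\<Sum>c. (p h c - p h' c) * (ln (p h c) - ln (p h' c))\<close> of the two Gibbs measures is
  linear in the difference of their means, which agree, so it vanishes. Its terms are nonnegative
  because \<open>ln\<close> is increasing; hence the measures coincide, and the energy difference
  \<open>D\<close> is constant.\<close>

lemma associated_fields_unique:
  assumes "associated_fields lam l m h" "associated_fields lam l m h'"
  shows "h = h'"
proof -
  define C where "C = configs {1..l}"
  define Z where "Z = Z_column lam l"
  define p where "p = (\<lambda>h c. column_weight lam l h c / Z h)"
  define D where "D = (\<lambda>c. \<Sum>i=1..l. (h i - h' i) * c i)"
  have Zpos: "Z h > 0" for h by (simp add: Z_def Z_column_pos)
  have ppos: "p h c > 0" for h c by (simp add: p_def column_weight_pos Zpos)
  have p1: "(\<Sum>c\<in>C. p h c) = 1" for h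
    using Zpos[of h] by (simp add: p_def C_def Z_def Z_column_eq flip: sum_divide_distrib)
  have pm: "(\<Sum>c\<in>C. c i * p g c) = m i" if "associated_fields lam l m g" "i \<in> {1..l}" for g i
  proof -
    have "(\<Sum>c\<in>C. c i * column_weight lam l g c) - m i * Z g = 0"
      using that by (simp add: associated_fields_iff C_def Z_def Z_column_eq sum_distrib_left
          sum_subtractf left_diff_distrib)
    moreover have "(\<Sum>c\<in>C. c i * p g c) = (\<Sum>c\<in>C. c i * column_weight lam l g c) / Z g"
      by (simp add: p_def sum_divide_distrib)
    ultimately show ?thesis using Zpos[of g] by (simp add: field_simps)
  qed
  have lnp: "ln (p h c) - ln (p h' c) = D c - (ln (Z h) - ln (Z h'))" for c
  proof -
    have "ln (p g c) = (\<Sum>i=1..l. lam * c i * c (next_site l i) + g i * c i) - ln (Z g)" for g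
      using Zpos[of g] by (simp add: p_def ln_div column_weight_pos) (simp add: column_weight_def)
    then show ?thesis by (simp add: D_def sum.distrib left_diff_distrib sum_subtractf)
  qed
  have "(\<Sum>c\<in>C. (p h c - p h' c) * (ln (p h c) - ln (p h' c))) =
      (\<Sum>c\<in>C. (p h c - p h' c) * D c) - (ln (Z h) - ln (Z h')) * ((\<Sum>c\<in>C. p h c) - (\<Sum>c\<in>C. p h' c))"
    unfolding lnp sum_distrib_left sum_subtractf[symmetric] by (intro sum.cong) (auto simp: algebra_simps)
  also have "\<dots> = (\<Sum>c\<in>C. (p h c - p h' c) * D c)" by (simp add: p1)
  also have "\<dots> = (\<Sum>i=1..l. \<Sum>c\<in>C. (p h c - p h' c) * ((h i - h' i) * c i))"
    unfolding D_def sum_distrib_left by (rule sum.swap)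
  also have "\<dots> = (\<Sum>i=1..l. (h i - h' i) * ((\<Sum>c\<in>C. c i * p h c) - (\<Sum>c\<in>C. c i * p h' c)))"
    unfolding sum_distrib_left sum_subtractf[symmetric] by (intro sum.cong) (auto simp: algebra_simps)
  also have "\<dots> = 0" using pm assms by simp
  finally have S0: "(\<Sum>c\<in>C. (p h c - p h' c) * (ln (p h c) - ln (p h' c))) = 0" .
  have nonneg: "(p h c - p h' c) * (ln (p h c) - ln (p h' c)) \<ge> 0" for c
    using ppos[of h c] ppos[of h' c] by (auto simp: zero_le_mult_iff)
  have "(p h c - p h' c) * (ln (p h c) - ln (p h' c)) = 0" if "c \<in> C" for c
    using S0 that nonneg finite_configs[of "{1..l}"]
    by (subst (asm) sum_nonneg_eq_0_iff) (auto simp: C_def)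
  then have "ln (p h c) = ln (p h' c)" if "c \<in> C" for c
    using that by fastforce
  then have D0: "D c = ln (Z h) - ln (Z h')" if "c \<in> C" for c
    using that lnp[of c] by simp
  have "h i = h' i" if i: "i \<in> {1..l}" for i
  proof -
    \<comment> \<open>Flipping site \<open>i\<close> in the all-plus configuration changes
      \<open>D\<close> by exactly \<open>2 * (h i - h' i)\<close>, while \<open>D\<close> is
      constant.\<close>
    define c :: "nat \<Rightarrow> real" where "c = (\<lambda>j\<in>{1..l}. 1)"
    have c: "c \<in> C" "c(i := -1) \<in> C"
      using i by (auto simp: C_def c_def configs_def PiE_iff extensional_def)
    have "D c - D (c(i := -1)) = (\<Sum>j=1..l. if j = i then 2 * (h i - h' i) else 0)"
      unfolding D_def sum_subtractf[symmetric] by (intro sum.cong) (auto simp: c_def)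
    also have "\<dots> = 2 * (h i - h' i)" using i by simp
    finally show ?thesis using D0[OF c(1)] D0[OF c(2)] by simp
  qed
  then show ?thesis
    using assms by (intro extensionalityI[of _ "{1..l}"]) (auto simp: associated_fields_def)
qed

text \<open>The fields minimise \<open>Z(h) exp (- (\<Sum>i. h i * m i))\<close>, which is coercive because
  \<open>\<bar>m i\<bar> < 1\<close>: keep only the configuration with \<open>c i = sgn (h i)\<close>.\<close>

lemma associated_fields_exist:
  assumes lam: "lam \<ge> 0" and M: "M < 1" and m: "\<And>i. i \<in> {1..l} \<Longrightarrow> \<bar>m i\<bar> \<le> M"
  shows "\<exists>h. associated_fields lam l m h"
proof -
  define C where "C = configs {1..l}"
  define G where "G = (\<lambda>h. \<Sum>c\<in>C. exp (\<Sum>i=1..l. lam * c i * c (next_site l i) + h i * (c i - m i)))"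
  \<comment> \<open>The radius solves \<open>R * (1 - M) - lam * l = ln (G (\<lambda>_. 0))\<close>:
    once some field exceeds it in modulus, the sign configuration alone contributes more than the
    whole value at zero.\<close>
  define R where "R = (ln (G (\<lambda>_. 0)) + lam * l) / (1 - M)"
  define h0 :: "nat \<Rightarrow> real" where "h0 = (\<lambda>i\<in>{1..l}. 0)"
  have finC: "finite C" by (simp add: C_def finite_configs)
  have Cne: "C \<noteq> {}" by (simp add: C_def configs_nonempty)
  have G0pos: "G (\<lambda>_. 0) > 0" unfolding G_def using finC Cne by (intro sum_pos) auto
  have Gh0: "G h0 = G (\<lambda>_. 0)" by (auto simp: G_def h0_def intro!: sum.cong arg_cong[where f=exp])
  have "lam * real l \<ge> 0" using lam by simp
  have coer: "G h > G h0" if "j \<in> {1..l}" "\<bar>h j\<bar> > R" for h j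
  proof -
    define c where "c = (\<lambda>i\<in>{1..l}. if h i < 0 then -1 else (1::real))"
    have c: "c \<in> C" by (auto simp: c_def C_def configs_def)
    have "ln (G h0) = R * (1 - M) - lam * l" using M by (simp add: R_def Gh0)
    also have "\<dots> < \<bar>h j\<bar> * (1 - M) - lam * l" using that M by simp
    also have "\<dots> \<le> (\<Sum>i=1..l. \<bar>h i\<bar> * (1 - M)) - lam * l"
      using that M member_le_sum[of j "{1..l}" "\<lambda>i. \<bar>h i\<bar> * (1 - M)"] by simp
    also have "\<dots> = (\<Sum>i=1..l. - lam + \<bar>h i\<bar> * (1 - M))"
      by (simp only: sum.distrib) simp
    also have "\<dots> \<le> (\<Sum>i=1..l. lam * c i * c (next_site l i) + h i * (c i - m i))"
    proof (rule sum_mono, rule add_mono)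
      fix i assume i: "i \<in> {1..l}"
      show "- lam \<le> lam * c i * c (next_site l i)"
        using i next_site_in[OF i] lam by (auto simp: c_def)
      have "\<bar>h i\<bar> * (1 - M) \<le> \<bar>h i\<bar> * (1 - \<bar>m i\<bar>)" using m[OF i] by (intro mult_left_mono) auto
      also have "\<dots> = \<bar>h i\<bar> - \<bar>h i * m i\<bar>" by (simp add: algebra_simps abs_mult)
      also have "\<dots> \<le> \<bar>h i\<bar> - h i * m i" by simp
      also have "\<dots> = h i * (c i - m i)" using i by (auto simp: c_def algebra_simps)
      finally show "\<bar>h i\<bar> * (1 - M) \<le> h i * (c i - m i)" .
    qed
    finally have "exp (ln (G h0)) < exp (\<Sum>i=1..l. lam * c i * c (next_site l i) + h i * (c i - m i))"
      by simp
    also have "\<dots> \<le> G h" unfolding G_def using c finC by (intro member_le_sum) auto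
    finally show ?thesis using G0pos Gh0 by simp
  qed
  \<comment> \<open>The factor \<open>{undefined}\<close> off \<open>{1..l}\<close> makes the
    elements extensional and \<open>K\<close> a product of compact sets in the space of all
    functions. With \<open>\<bar>R\<bar>\<close> in place of \<open>R\<close> the box contains
    \<open>h0\<close> without any discussion of the sign of \<open>R\<close>.\<close>
  define K :: "(nat \<Rightarrow> real) set" where "K = Pi\<^sub>E UNIV (\<lambda>i. if i \<in> {1..l} then {-\<bar>R\<bar>..\<bar>R\<bar>} else {undefined})"
  have "compactin (product_topology (\<lambda>_. euclidean) UNIV) K"
    unfolding K_def by (subst compactin_PiE) (auto simp: compactin_euclidean_iff)
  then have "compact K" by (simp add: euclidean_product_topology)
  moreover have h0K: "h0 \<in> K" by (auto simp: K_def h0_def)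
  moreover have "continuous_on K G" unfolding G_def
    by (intro continuous_intros continuous_on_product_then_coordinatewise[OF continuous_on_id, unfolded id_def])
  ultimately obtain h where hK: "h \<in> K" and hmin: "\<And>g. g \<in> K \<Longrightarrow> G h \<le> G g"
    using continuous_attains_inf[of K G] by blast
  have min: "G h \<le> G g" if "g \<in> extensional {1..l}" for g
  proof (cases "\<exists>j\<in>{1..l}. \<bar>g j\<bar> > R")
    case True
    then show ?thesis using coer hmin[OF h0K] by force
  next
    case False
    then have "g i \<in> {-\<bar>R\<bar>..\<bar>R\<bar>}" if "i \<in> {1..l}" for i using that by force
    then have "g \<in> K" using that by (simp add: K_def PiE_iff extensional_def)
    then show ?thesis by (rule hmin)
  qed
  have hext: "h \<in> extensional {1..l}" using hK by (auto simp: K_def PiE_iff extensional_def split: if_splits)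
  have GZ: "G g = Z_column lam l g * exp (- (\<Sum>i=1..l. g i * m i))" for g
    unfolding G_def Z_column_def C_def sum_distrib_right exp_add[symmetric]
    by (simp add: right_diff_distrib sum.distrib sum_subtractf add_diff_eq)
  have "(\<Sum>c\<in>C. (c i - m i) * column_weight lam l h c) = 0" if i: "i \<in> {1..l}" for i
  proof -
    define E where "E = exp (- (\<Sum>i=1..l. h i * m i))"
    have GE: "G (h(i := t)) = (\<Sum>c\<in>C. column_weight lam l h c * exp ((t - h i) * (c i - m i))) * E" for t
    proof -
      have "(\<Sum>j=1..l. (h(i := t)) j * m j) = (\<Sum>j=1..l. h j * m j) + (\<Sum>j = 1..l. if j = i then (t - h i) * m i else 0)"
        unfolding sum.distrib[symmetric] by (intro sum.cong) (auto simp: algebra_simps)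
      also have "(\<Sum>j = 1..l. if j = i then (t - h i) * m i else 0) = (t - h i) * m i"
        using i by simp
      finally have *: "exp (- (\<Sum>j=1..l. (h(i := t)) j * m j)) = E * exp (- (t - h i) * m i)"
        by (simp add: E_def algebra_simps flip: exp_add)
      have "exp ((t - h i) * (c i - m i)) = exp ((t - h i) * c i) * exp (- (t - h i) * m i)" for c
        by (simp add: algebra_simps flip: exp_add)
      then show ?thesis
        unfolding GZ * Z_column_eq column_weight_upd[OF i] C_def sum_distrib_right
        by (simp only: mult_ac)
    qed
    have "((\<lambda>t. G (h(i := t))) has_real_derivative (\<Sum>c\<in>C. (c i - m i) * column_weight lam l h c) * E) (at (h i))"
      unfolding GE by (auto intro!: derivative_eq_intros sum.cong simp: algebra_simps sum_distrib_left)
    moreover have "\<forall>t. \<bar>h i - t\<bar> < 1 \<longrightarrow> G (h(i := h i)) \<le> G (h(i := t))"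
      using min hext i by (auto simp: extensional_def)
    ultimately have "(\<Sum>c\<in>C. (c i - m i) * column_weight lam l h c) * E = 0"
      by (intro DERIV_local_min[of "\<lambda>t. G (h(i := t))" _ "h i" 1]) auto
    then show ?thesis by (simp add: E_def)
  qed
  then show ?thesis using hext by (auto simp: associated_fields_iff C_def)
qed

subsection \<open>The fields are bounded\<close>

lemma sum_of_bool: "finite A \<Longrightarrow> (\<Sum>i\<in>A. of_bool (P i)) = real (card {i\<in>A. P i})"
  by (simp add: of_bool_def sum.If_cases Int_def)

definition interaction :: "nat \<Rightarrow> (nat \<Rightarrow> real) \<Rightarrow> real" where
  "interaction l c = (\<Sum>i=1..l. c i * c (next_site l i))"

text \<open>A site where the configurations differ touches two bonds, and each bond changes by at
  most 2; this gives the factor 4.\<close>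

lemma interaction_diff:
  assumes "c \<in> configs {1..l}" "c' \<in> configs {1..l}"
  shows "\<bar>interaction l c - interaction l c'\<bar>
           \<le> 4 * real (card {i\<in>{1..l}. c i \<noteq> c' i})"
proof -
  define d where "d = (\<lambda>i. of_bool (c i \<noteq> c' i) :: real)"
  have "\<bar>interaction l c - interaction l c'\<bar> =
     \<bar>\<Sum>i=1..l. c i * c (next_site l i) - c' i * c' (next_site l i)\<bar>"
    by (simp add: interaction_def sum_subtractf)
  also have "\<dots> \<le> (\<Sum>i=1..l. \<bar>c i * c (next_site l i) - c' i * c' (next_site l i)\<bar>)"
    by (rule sum_abs)
  also have "\<dots> \<le> (\<Sum>i=1..l. 2 * d i + 2 * d (next_site l i))"
  proof (rule sum_mono)
    fix i assume i: "i \<in> {1..l}"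
    show "\<bar>c i * c (next_site l i) - c' i * c' (next_site l i)\<bar> \<le> 2 * d i + 2 * d (next_site l i)"
      using configs_apply[OF assms(1) i] configs_apply[OF assms(2) i]
        configs_apply[OF assms(1) next_site_in[OF i]] configs_apply[OF assms(2) next_site_in[OF i]]
      by (elim disjE) (simp_all add: d_def)
  qed
  also have "\<dots> = 2 * (\<Sum>i=1..l. d i) + 2 * (\<Sum>i=1..l. d (next_site l i))"
    by (simp only: sum.distrib sum_distrib_left)
  also have "\<dots> = 4 * (\<Sum>i=1..l. d i)" by (simp only: sum_next_site)
  also have "(\<Sum>i=1..l. d i) = real (card {i\<in>{1..l}. c i \<noteq> c' i})"
    unfolding d_def by (rule sum_of_bool) simp
  finally show ?thesis .
qed

lemma field_diff:
  fixes h :: "nat \<Rightarrow> real"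
  assumes "c \<in> configs {1..l}" "c' \<in> configs {1..l}" "\<And>i. i \<in> {1..l} \<Longrightarrow> \<bar>h i\<bar> \<le> B"
  shows "(\<Sum>i=1..l. h i * c i) - (\<Sum>i=1..l. h i * c' i) \<le> 2 * B * real (card {i\<in>{1..l}. c i \<noteq> c' i})"
proof -
  have "(\<Sum>i=1..l. h i * c i) - (\<Sum>i=1..l. h i * c' i) = (\<Sum>i=1..l. h i * (c i - c' i))"
    by (simp add: sum_subtractf right_diff_distrib)
  also have "\<dots> \<le> (\<Sum>i=1..l. 2 * B * of_bool (c i \<noteq> c' i))"
  proof (rule sum_mono)
    fix i assume i: "i \<in> {1..l}"
    show "h i * (c i - c' i) \<le> 2 * B * of_bool (c i \<noteq> c' i)"
      using configs_apply[OF assms(1) i] configs_apply[OF assms(2) i] assms(3)[OF i] by auto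
  qed
  also have "\<dots> = 2 * B * (\<Sum>i=1..l. of_bool (c i \<noteq> c' i))" by (simp only: sum_distrib_left)
  also have "(\<Sum>i=1..l. of_bool (c i \<noteq> c' i)) = real (card {i\<in>{1..l}. c i \<noteq> c' i})"
    by (rule sum_of_bool) simp
  finally show ?thesis .
qed

lemma column_weight_exp:
  "column_weight lam l h c = exp (lam * interaction l c + (\<Sum>i=1..l. h i * c i))"
  by (simp add: column_weight_def interaction_def sum.distrib sum_distrib_left mult.assoc)

text \<open>Each differing site costs at most \<open>4 * lam\<close> through its bonds and
  \<open>2 * B\<close> through its field. The price \<open>4 * lam + 2 * B\<close> per flip is
  carried unchanged into the final constant.\<close>

lemma column_weight_ratio:
  assumes "lam \<ge> 0" "c \<in> configs {1..l}" "c' \<in> configs {1..l}" "\<And>i. i \<in> {1..l} \<Longrightarrow> \<bar>h i\<bar> \<le> B"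
  shows "column_weight lam l h c \<le>
    exp ((4 * lam + 2 * B) * real (card {i\<in>{1..l}. c i \<noteq> c' i})) * column_weight lam l h c'"
proof -
  define d where "d = real (card {i\<in>{1..l}. c i \<noteq> c' i})"
  have "lam * (interaction l c - interaction l c') \<le> lam * (4 * d)"
    using interaction_diff[OF assms(2,3)] assms(1) unfolding d_def
    by (intro mult_left_mono) linarith+
  moreover have "(\<Sum>i=1..l. h i * c i) - (\<Sum>i=1..l. h i * c' i) \<le> 2 * B * d"
    using field_diff[OF assms(2,3), of h B] assms(4) by (simp add: d_def)
  ultimately show ?thesis
    unfolding column_weight_exp d_def[symmetric] exp_add[symmetric]
    by (simp add: algebra_simps)
qed

text \<open>Only the interaction is estimated; the field term stays exact, because the purpose is to
  derive a bound on \<open>h i\<close> and none is available yet.\<close>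

lemma column_weight_flip:
  assumes "lam \<ge> 0" "i \<in> {1..l}" "c \<in> configs {1..l}"
  shows "column_weight lam l h c * exp (- 2 * h i * c i - 4 * lam) \<le> column_weight lam l h (c(i := - c i))"
proof -
  have c': "c(i := - c i) \<in> configs {1..l}"
    using assms configs_apply[OF assms(3,2)] by (intro configs_upd) auto
  have "{j\<in>{1..l}. c j \<noteq> (c(i := - c i)) j} = {i}"
    using assms(2) configs_apply[OF assms(3,2)] by auto
  then have "lam * (interaction l c - interaction l (c(i := - c i))) \<le> lam * 4"
    using interaction_diff[OF assms(3) c'] assms(1) 
    by (intro mult_left_mono) auto
  moreover have "(\<Sum>j=1..l. h j * (c(i := - c i)) j) = (\<Sum>j=1..l. h j * c j) + (\<Sum>j=1..l. if j = i then - 2 * h i * c i else 0)"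
    unfolding sum.distrib[symmetric] by (intro sum.cong) auto
  moreover have "(\<Sum>j=1..l. if j = i then - 2 * h i * c i else 0) = - 2 * h i * c i"
    using assms(2) by simp
  ultimately show ?thesis
    unfolding column_weight_exp exp_add[symmetric]
    by (simp add: algebra_simps)
qed

text \<open>Let \<open>P s\<close> be the weight of \<open>c i = s\<close>. The mean equation fixes
  the ratio of \<open>P s\<close> to \<open>P (- s)\<close> as
  \<open>(1 + s * m i) / (1 - s * m i)\<close>, at least \<open>(1 - M) / 2\<close>. Flipping spin
  \<open>i\<close> gives \<open>P s * exp (- 2 * h i * s - 4 * lam) \<le> P (- s)\<close>, so
  \<open>- s * h i\<close> cannot be large. The bound does not involve \<open>l\<close>.\<close>

lemma associated_fields_bound:
  assumes "lam \<ge> 0" "M < 1" "associated_fields lam l m h" "i \<in> {1..l}" "\<bar>m i\<bar> \<le> M"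
  shows "\<bar>h i\<bar> \<le> 2 * lam + ln (2 / (1 - M)) / 2"
proof -
  define C where "C = configs {1..l}"
  define P where "P = (\<lambda>s. \<Sum>c\<in>{c\<in>C. c i = s}. column_weight lam l h c)"
  have finC: "finite C" by (simp add: C_def finite_configs)
  have *: "- s * h i \<le> 2 * lam + ln (2 / (1 - M)) / 2" if s: "s \<in> {-1, 1}" for s
  proof -
    have C: "C = {c\<in>C. c i = 1} \<union> {c\<in>C. c i = -1}"
      using configs_apply[OF _ assms(4)] by (auto simp: C_def)
    have "(\<Sum>c\<in>C. (c i - m i) * column_weight lam l h c) =
       (\<Sum>c\<in>{c\<in>C. c i = 1}. (c i - m i) * column_weight lam l h c) +
       (\<Sum>c\<in>{c\<in>C. c i = -1}. (c i - m i) * column_weight lam l h c)"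
      using finC by (subst C, subst sum.union_disjoint) auto
    also have "\<dots> = (1 - m i) * P 1 + (-1 - m i) * P (-1)"
      unfolding P_def sum_distrib_left by (intro arg_cong2[where f="(+)"] sum.cong) auto
    finally have balance: "(1 - m i) * P 1 = (1 + m i) * P (-1)"
      using assms(3,4) by (simp add: associated_fields_iff C_def algebra_simps)
    have "P s * exp (- 2 * h i * s - 4 * lam) \<le> (\<Sum>c\<in>{c\<in>C. c i = s}. column_weight lam l h (c(i := - c i)))"
      unfolding P_def sum_distrib_right
      using column_weight_flip[OF assms(1,4)] by (intro sum_mono) (auto simp: C_def)
    also have "\<dots> = P (- s)" unfolding P_def
      using s configs_upd[OF _ assms(4)]
      by (intro sum.reindex_bij_witness[of _ "\<lambda>c. c(i := - c i)" "\<lambda>c. c(i := - c i)"]) (auto simp: C_def)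
    finally have flip: "P s * exp (- 2 * h i * s - 4 * lam) \<le> P (- s)" .
    have P0: "P 1 \<ge> 0" "P (-1) \<ge> 0" by (auto simp: P_def intro!: sum_nonneg less_imp_le[OF column_weight_pos])
    have "P 1 + P (-1) = Z_column lam l h"
      unfolding Z_column_eq P_def C_def[symmetric] using finC
      by (subst (3) C, subst sum.union_disjoint) auto
    then have Psum: "P 1 + P (-1) > 0" using Z_column_pos[of lam l h] by simp
    have "s * m i \<le> M" "- s * m i \<le> M" "M \<ge> 0" using s assms(5) by auto
    have P2: "P (- s) > 0"
    proof (rule ccontr)
      assume "\<not> P (- s) > 0"
      then have "P (- s) = 0" using P0 s by auto
      then have "P s * exp (- 2 * h i * s - 4 * lam) \<le> 0" using flip by simp
      then have "P s = 0" using P0 s by (auto simp: mult_le_0_iff not_le)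
      then show False using Psum \<open>P (- s) = 0\<close> s by auto
    qed
    have bal: "(1 - s * m i) * P s = (1 + s * m i) * P (- s)" using balance s by auto
    have "(1 + s * m i) * P (- s) * exp (- 2 * h i * s - 4 * lam) \<le> (1 - s * m i) * P (- s)"
      using mult_left_mono[OF flip, of "1 - s * m i"] \<open>s * m i \<le> M\<close> assms(2) bal
      by (simp add: mult.assoc[symmetric])
    then have "(1 + s * m i) * exp (- 2 * h i * s - 4 * lam) * P (- s) \<le> (1 - s * m i) * P (- s)"
      by (simp add: mult_ac)
    then have "(1 + s * m i) * exp (- 2 * h i * s - 4 * lam) \<le> 1 - s * m i"
      using P2 by simp
    moreover have "(1 - M) * exp (- 2 * h i * s - 4 * lam) \<le> (1 + s * m i) * exp (- 2 * h i * s - 4 * lam)"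
      using \<open>- s * m i \<le> M\<close> by (intro mult_right_mono) auto
    ultimately have "(1 - M) * exp (- 2 * h i * s - 4 * lam) \<le> 2"
      using \<open>- s * m i \<le> M\<close> assms(2) by linarith
    then have "exp (- 2 * h i * s - 4 * lam) \<le> 2 / (1 - M)"
      using assms(2) by (simp add: field_simps)
    then have "- 2 * h i * s - 4 * lam \<le> ln (2 / (1 - M))"
      using assms(2) by (subst ln_ge_iff) auto
    then show ?thesis by (simp add: field_simps)
  qed
  show ?thesis using *[of 1] *[of "-1"] by auto
qed

subsection \<open>Second moments of sums under a product weight\<close>

text \<open>Variance of a sum of independent centred variables, for weights that are not normalised.
  An off-diagonal pair contains the vanishing factor \<open>\<Sum>c\<in>C. w c * g c\<close>; a
  diagonal one leaves \<open>card X - 1\<close> coordinates that each contribute the total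
  mass.\<close>

lemma product_weight_second_moment:
  fixes w g :: "'b \<Rightarrow> real"
  assumes X: "finite X" and C: "finite C" and centred: "(\<Sum>c\<in>C. w c * g c) = 0"
  shows "(\<Sum>\<tau>\<in>X \<rightarrow>\<^sub>E C. (\<Prod>x\<in>X. w (\<tau> x)) * (\<Sum>x\<in>X. g (\<tau> x))\<^sup>2) =
    real (card X) * ((\<Sum>c\<in>C. w c) ^ (card X - 1) * (\<Sum>c\<in>C. w c * (g c)\<^sup>2))"
proof -
  have pair: "(\<Sum>\<tau>\<in>X \<rightarrow>\<^sub>E C. (\<Prod>z\<in>X. w (\<tau> z)) * (g (\<tau> x) * g (\<tau> y))) =
     (if x = y then (\<Sum>c\<in>C. w c) ^ (card X - 1) * (\<Sum>c\<in>C. w c * (g c)\<^sup>2) else 0)"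
    if x: "x \<in> X" and y: "y \<in> X" for x y
  proof -
    \<comment> \<open>The factors \<open>g\<close> are attached to the coordinates \<open>x\<close>
      and \<open>y\<close>, so the summand is a product over coordinates and the sum over the
      product space factorises. Two separate conditionals make \<open>x = y\<close> produce the
      square.\<close>
    define f where "f = (\<lambda>z c. w c * (if z = x then g c else 1) * (if z = y then g c else 1))"
    have "(\<Prod>z\<in>X. w (\<tau> z)) * (g (\<tau> x) * g (\<tau> y)) = (\<Prod>z\<in>X. f z (\<tau> z))" for \<tau>
    proof -
      have "(\<Prod>z\<in>X. if z = v then g (\<tau> z) else 1) = g (\<tau> v)" if "v \<in> X" for v
        using that X by simp
      then show ?thesis using x y by (simp add: f_def prod.distrib mult.assoc)
    qed
    then have "(\<Sum>\<tau>\<in>X \<rightarrow>\<^sub>E C. (\<Prod>z\<in>X. w (\<tau> z)) * (g (\<tau> x) * g (\<tau> y))) = (\<Prod>z\<in>X. \<Sum>c\<in>C. f z c)"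
      using X C by (simp add: prod_sum_PiE)
    also have "\<dots> = (\<Sum>c\<in>C. f x c) * (\<Prod>z\<in>X - {x}. \<Sum>c\<in>C. f z c)"
      by (rule prod.remove[OF X x])
    also have "\<dots> = (if x = y then (\<Sum>c\<in>C. w c) ^ (card X - 1) * (\<Sum>c\<in>C. w c * (g c)\<^sup>2) else 0)"
    proof (cases "x = y")
      case True
      then have "(\<Prod>z\<in>X - {x}. \<Sum>c\<in>C. f z c) = (\<Prod>z\<in>X - {x}. \<Sum>c\<in>C. w c)"
        by (intro prod.cong sum.cong) (auto simp: f_def)
      then show ?thesis using True X x by (simp add: f_def power2_eq_square mult_ac)
    next
      case False
      then show ?thesis using centred by (simp add: f_def)
    qed
    finally show ?thesis .
  qed
  have "(\<Sum>\<tau>\<in>X \<rightarrow>\<^sub>E C. (\<Prod>x\<in>X. w (\<tau> x)) * (\<Sum>x\<in>X. g (\<tau> x))\<^sup>2) =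
     (\<Sum>\<tau>\<in>X \<rightarrow>\<^sub>E C. \<Sum>x\<in>X. \<Sum>y\<in>X. (\<Prod>z\<in>X. w (\<tau> z)) * (g (\<tau> x) * g (\<tau> y)))"
    by (simp only: power2_eq_square sum_product) (simp only: sum_distrib_left)
  also have "\<dots> = (\<Sum>x\<in>X. \<Sum>\<tau>\<in>X \<rightarrow>\<^sub>E C. \<Sum>y\<in>X. (\<Prod>z\<in>X. w (\<tau> z)) * (g (\<tau> x) * g (\<tau> y)))"
    by (rule sum.swap)
  also have "\<dots> = (\<Sum>x\<in>X. \<Sum>y\<in>X. \<Sum>\<tau>\<in>X \<rightarrow>\<^sub>E C. (\<Prod>z\<in>X. w (\<tau> z)) * (g (\<tau> x) * g (\<tau> y)))"
    by (intro sum.cong sum.swap refl)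
  also have "\<dots> = (\<Sum>x\<in>X. \<Sum>y\<in>X. if x = y then (\<Sum>c\<in>C. w c) ^ (card X - 1) * (\<Sum>c\<in>C. w c * (g c)\<^sup>2) else 0)"
    by (intro sum.cong pair refl)
  finally show ?thesis using X by simp
qed

subsection \<open>Hamming balls\<close>

lemma finite_subsets_card_le: "finite A \<Longrightarrow> finite {S. S \<subseteq> A \<and> card S \<le> K}"
  by (rule finite_subset[of _ "Pow A"]) auto

text \<open>A set of size at most \<open>Suc K\<close> is the union of one of size at most
  \<open>K\<close> and a set that is empty or a singleton; the latter offers
  \<open>card A + 1\<close> choices.\<close>

lemma card_subsets_card_le:
  assumes "finite A"
  shows "card {S. S \<subseteq> A \<and> card S \<le> K} \<le> (card A + 1) ^ K"
proof (induction K)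
  case 0
  have "{S. S \<subseteq> A \<and> card S \<le> 0} = {{}}" using assms finite_subset by fastforce
  then show ?case by simp
next
  case (Suc K)
  let ?F = "\<lambda>K. {S. S \<subseteq> A \<and> card S \<le> K}" and ?P = "insert {} ((\<lambda>a. {a}) ` A)"
  have "?F (Suc K) \<subseteq> (\<lambda>(S, P). S \<union> P) ` (?F K \<times> ?P)"
  proof
    fix S assume S: "S \<in> ?F (Suc K)"
    then have finS: "finite S" using assms finite_subset by auto
    show "S \<in> (\<lambda>(S, P). S \<union> P) ` (?F K \<times> ?P)"
    proof (cases "S = {}")
      case True
      then show ?thesis by (intro image_eqI[of _ _ "({}, {})"]) auto
    next
      case False
      then obtain a where a: "a \<in> S" by blast
      then show ?thesis using S finS
        by (intro image_eqI[of _ _ "(S - {a}, {a})"]) (auto simp: card_Diff_singleton)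
    qed
  qed
  then have "card (?F (Suc K)) \<le> card ((\<lambda>(S, P). S \<union> P) ` (?F K \<times> ?P))"
    using assms by (intro card_mono finite_imageI finite_cartesian_product finite_subsets_card_le) auto
  also have "\<dots> \<le> card (?F K \<times> ?P)"
    using assms by (intro card_image_le finite_cartesian_product finite_subsets_card_le) auto
  also have "\<dots> = card (?F K) * card ?P" by (rule card_cartesian_product)
  also have "card ?P \<le> card A + 1"
    using assms card_image_le[of A "\<lambda>a. {a}"] by (simp add: card_insert_if)
  then have "card (?F K) * card ?P \<le> (card A + 1) ^ K * (card A + 1)"
    by (intro mult_le_mono Suc.IH)
  finally show ?case by (simp add: mult.commute)
qed

definition discrepancy :: "'a set \<Rightarrow> ('a \<Rightarrow> real) \<Rightarrow> ('a \<Rightarrow> real) \<Rightarrow> 'a set" where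
  "discrepancy A \<sigma> \<tau> = {a\<in>A. \<sigma> a \<noteq> \<tau> a}"

text \<open>Spins take two values, so a configuration is recovered from \<open>\<tau>\<close> and
  the set of sites where it differs from \<open>\<tau>\<close>. This injects the ball into the small
  subsets of \<open>A\<close>.\<close>

lemma card_hamming_ball:
  assumes "finite A" "\<tau> \<in> configs A"
  shows "card {\<sigma>\<in>configs A. card (discrepancy A \<sigma> \<tau>) \<le> K} \<le> (card A + 1) ^ K"
proof -
  have "inj_on (\<lambda>\<sigma>. discrepancy A \<sigma> \<tau>) (configs A)"
  proof (rule inj_onI)
    fix \<sigma> \<sigma>' assume s: "\<sigma> \<in> configs A" "\<sigma>' \<in> configs A"
      and eq: "discrepancy A \<sigma> \<tau> = discrepancy A \<sigma>' \<tau>"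
    show "\<sigma> = \<sigma>'"
    proof (rule PiE_ext[OF s[unfolded configs_def]])
      fix a assume a: "a \<in> A"
      then have "\<sigma> a = \<tau> a \<longleftrightarrow> \<sigma>' a = \<tau> a" using eq by (auto simp: discrepancy_def)
      then show "\<sigma> a = \<sigma>' a"
        using configs_apply[OF s(1) a] configs_apply[OF s(2) a] configs_apply[OF assms(2) a] by auto
    qed
  qed
  then have "card {\<sigma>\<in>configs A. card (discrepancy A \<sigma> \<tau>) \<le> K} \<le> card {S. S \<subseteq> A \<and> card S \<le> K}"
    using assms
    by (intro card_inj_on_le[of "\<lambda>\<sigma>. discrepancy A \<sigma> \<tau>"] finite_subsets_card_le)
      (auto intro: inj_on_subset simp: discrepancy_def)
  also have "\<dots> \<le> (card A + 1) ^ K" by (rule card_subsets_card_le[OF assms(1)])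
  finally show ?thesis .
qed

text \<open>Double counting for a many-valued map: every \<open>\<sigma>\<close> is charged to all
  its related \<open>\<tau>\<close>, of which there is at least one, and no \<open>\<tau>\<close>
  receives more than \<open>N\<close> charges. Working with a relation avoids selecting one repaired
  configuration for each \<open>\<sigma>\<close>.\<close>

lemma sum_le_sum_of_related:
  fixes w :: "'a \<Rightarrow> real"
  assumes "finite S" "finite T" "q \<ge> 0" "\<And>\<tau>. \<tau> \<in> T \<Longrightarrow> w \<tau> \<ge> 0"
    and ex: "\<And>\<sigma>. \<sigma> \<in> S \<Longrightarrow> \<exists>\<tau>\<in>T. R \<sigma> \<tau>"
    and ratio: "\<And>\<sigma> \<tau>. \<sigma> \<in> S \<Longrightarrow> \<tau> \<in> T \<Longrightarrow> R \<sigma> \<tau> \<Longrightarrow> w \<sigma> \<le> q * w \<tau>"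
    and count: "\<And>\<tau>. \<tau> \<in> T \<Longrightarrow> real (card {\<sigma>\<in>S. R \<sigma> \<tau>}) \<le> N"
  shows "(\<Sum>\<sigma>\<in>S. w \<sigma>) \<le> N * (q * (\<Sum>\<tau>\<in>T. w \<tau>))"
proof -
  have "(\<Sum>\<sigma>\<in>S. w \<sigma>) \<le> (\<Sum>\<sigma>\<in>S. \<Sum>\<tau>\<in>T. of_bool (R \<sigma> \<tau>) * (q * w \<tau>))"
  proof (rule sum_mono)
    fix \<sigma> assume s: "\<sigma> \<in> S"
    then obtain \<tau> where t: "\<tau> \<in> T" "R \<sigma> \<tau>" using ex by blast
    have "w \<sigma> \<le> of_bool (R \<sigma> \<tau>) * (q * w \<tau>)" using ratio[OF s t] t by simp
    also have "\<dots> \<le> (\<Sum>\<tau>\<in>T. of_bool (R \<sigma> \<tau>) * (q * w \<tau>))"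
      using assms t by (intro member_le_sum) auto
    finally show "w \<sigma> \<le> (\<Sum>\<tau>\<in>T. of_bool (R \<sigma> \<tau>) * (q * w \<tau>))" .
  qed
  also have "\<dots> = (\<Sum>\<tau>\<in>T. \<Sum>\<sigma>\<in>S. of_bool (R \<sigma> \<tau>) * (q * w \<tau>))" by (rule sum.swap)
  also have "\<dots> = (\<Sum>\<tau>\<in>T. (\<Sum>\<sigma>\<in>S. of_bool (R \<sigma> \<tau>)) * (q * w \<tau>))" by (simp only: sum_distrib_right)
  also have "\<dots> = (\<Sum>\<tau>\<in>T. real (card {\<sigma>\<in>S. R \<sigma> \<tau>}) * (q * w \<tau>))"
    by (intro sum.cong refl arg_cong2[where f="(*)"] sum_of_bool assms(1))
  also have "\<dots> \<le> (\<Sum>\<tau>\<in>T. N * (q * w \<tau>))"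
    using assms by (intro sum_mono mult_right_mono) auto
  finally show ?thesis by (simp add: sum_distrib_left)
qed

text \<open>With \<open>A\<close> the set of plus sites, a set \<open>B\<close> of size
  \<open>k\<close> can be chosen comparable to \<open>A\<close> under inclusion, so the symmetric
  difference has size \<open>\<bar>card A - k\<bar>\<close>, the fewest flips possible. Each flip
  moves the sum by 2.\<close>

lemma adjust_row_sum:
  fixes f :: "'a \<Rightarrow> real"
  assumes X: "finite X" and f: "\<And>x. x \<in> X \<Longrightarrow> f x = -1 \<or> f x = 1" and k: "k \<le> card X"
  shows "\<exists>g. (\<forall>x. g x \<in> {-1, 1}) \<and> (\<Sum>x\<in>X. g x) = 2 * real k - real (card X) \<and>
     2 * real (card {x\<in>X. f x \<noteq> g x}) = \<bar>(\<Sum>x\<in>X. f x) - (2 * real k - real (card X))\<bar>"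
proof -
  have sum_pm: "(\<Sum>x\<in>X. if x \<in> B then 1 else -1) = 2 * real (card B) - real (card X)" if "B \<subseteq> X" for B
  proof -
    have "(\<Sum>x\<in>X. if x \<in> B then 1 else (-1::real)) = real (card B) - real (card (X - B))"
      using X that by (simp add: sum.If_cases Int_absorb1 Diff_eq)
    then show ?thesis using X that by (simp add: card_Diff_subset finite_subset card_mono of_nat_diff)
  qed
  define A where "A = {x\<in>X. f x = 1}"
  have A: "A \<subseteq> X" "finite A" using X by (auto simp: A_def)
  have "(\<Sum>x\<in>X. f x) = (\<Sum>x\<in>X. if x \<in> A then 1 else -1)"
    using f by (intro sum.cong) (auto simp: A_def)
  then have sumf: "(\<Sum>x\<in>X. f x) = 2 * real (card A) - real (card X)" using sum_pm[OF A(1)] by simp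
  have "\<exists>B\<subseteq>X. card B = k \<and> real (card ((A - B) \<union> (B - A))) = \<bar>real (card A) - real k\<bar>"
  proof (cases "card A \<le> k")
    case True
    then obtain B where B: "A \<subseteq> B" "B \<subseteq> X" "card B = k"
      using exists_subset_between[OF True k A(1) X] by blast
    then have "(A - B) \<union> (B - A) = B - A" by auto
    then have "real (card ((A - B) \<union> (B - A))) = \<bar>real (card A) - real k\<bar>"
      using B A True by (simp add: card_Diff_subset of_nat_diff)
    then show ?thesis using B by blast
  next
    case False
    then obtain B where B: "B \<subseteq> A" "card B = k"
      using obtain_subset_with_card_n[of k A] by auto
    then have "(A - B) \<union> (B - A) = A - B" by auto
    then have "real (card ((A - B) \<union> (B - A))) = \<bar>real (card A) - real k\<bar>"
      using B A False finite_subset[OF B(1) A(2)] by (simp add: card_Diff_subset of_nat_diff)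
    then show ?thesis using B A by blast
  qed
  then obtain B where B: "B \<subseteq> X" "card B = k"
    "real (card ((A - B) \<union> (B - A))) = \<bar>real (card A) - real k\<bar>" by blast
  define g where "g = (\<lambda>x. if x \<in> B then 1 else (-1::real))"
  have "{x\<in>X. f x \<noteq> g x} = (A - B) \<union> (B - A)"
    using f B(1) by (force simp: g_def A_def)
  moreover have "(\<Sum>x\<in>X. g x) = 2 * real k - real (card X)"
    unfolding g_def using sum_pm[OF B(1)] B(2) by simp
  moreover have "2 * \<bar>real (card A) - real k\<bar> = \<bar>2 * real (card A) - 2 * real k\<bar>" by (simp add: abs_if)
  moreover have "\<forall>x. g x \<in> {-1, 1}" by (simp add: g_def)
  ultimately show ?thesis using B sumf by (intro exI[of _ g]) simp
qed

subsection \<open>Decomposition of the square into columns\<close>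

definition column :: "nat \<Rightarrow> (nat \<times> nat \<Rightarrow> real) \<Rightarrow> nat \<Rightarrow> nat \<Rightarrow> real" where
  "column l \<sigma> x = (\<lambda>i\<in>{1..l}. \<sigma> (x, i))"

definition square_weight :: "real \<Rightarrow> nat \<Rightarrow> (nat \<Rightarrow> real) \<Rightarrow> (nat \<times> nat \<Rightarrow> real) \<Rightarrow> real" where
  "square_weight lam l h \<sigma> = (\<Prod>x=1..l. column_weight lam l h (column l \<sigma> x))"

lemma column_in_configs: "\<sigma> \<in> configs (square l) \<Longrightarrow> x \<in> {1..l} \<Longrightarrow> column l \<sigma> x \<in> configs {1..l}"
  by (auto simp: configs_def square_def column_def PiE_iff)

text \<open>This is currying. The families of columns are restricted to \<open>{1..l}\<close>, so
  they range exactly over the extensional product space on which sums of products factorise.\<close>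

lemma sum_configs_square:
  "(\<Sum>\<sigma>\<in>configs (square l). F (\<lambda>x\<in>{1..l}. column l \<sigma> x)) = (\<Sum>\<tau>\<in>{1..l} \<rightarrow>\<^sub>E configs {1..l}. F \<tau>)"
proof (rule sum.reindex_bij_witness[of _ "\<lambda>\<tau>. \<lambda>(x, i)\<in>square l. \<tau> x i" "\<lambda>\<sigma>. \<lambda>x\<in>{1..l}. column l \<sigma> x"])
  fix \<sigma> assume s: "\<sigma> \<in> configs (square l)"
  show "(\<lambda>x\<in>{1..l}. column l \<sigma> x) \<in> {1..l} \<rightarrow>\<^sub>E configs {1..l}"
    using column_in_configs[OF s] by auto
  show "(\<lambda>(x, i)\<in>square l. (\<lambda>x\<in>{1..l}. column l \<sigma> x) x i) = \<sigma>"
    using s by (auto simp: fun_eq_iff configs_def square_def column_def PiE_iff extensional_def restrict_def)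
next
  fix \<tau> assume t: "\<tau> \<in> {1..l} \<rightarrow>\<^sub>E configs {1..l}"
  then have tx: "\<tau> x \<in> configs {1..l}" if "x \<in> {1..l}" for x using that by blast
  show "(\<lambda>(x, i)\<in>square l. \<tau> x i) \<in> configs (square l)"
  proof -
    have "\<tau> x i \<in> {-1, 1}" if "x \<in> {1..l}" "i \<in> {1..l}" for x i
      using configs_apply[OF tx that(2), OF that(1)] by auto
    then show ?thesis unfolding configs_def by (force simp: square_def)
  qed
  show "(\<lambda>x\<in>{1..l}. column l (\<lambda>(x, i)\<in>square l. \<tau> x i) x) = \<tau>"
  proof (rule extensionalityI[of _ "{1..l}"])
    fix x assume x: "x \<in> {1..l}"
    then show "(\<lambda>x\<in>{1..l}. column l (\<lambda>(x, i)\<in>square l. \<tau> x i) x) x = \<tau> x"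
      using tx[OF x] by (auto simp: fun_eq_iff column_def square_def restrict_def configs_def PiE_iff extensional_def)
  qed (use t in \<open>auto simp: PiE_iff\<close>)
qed simp

lemma square_weight_pos: "square_weight lam l h \<sigma> > 0"
  by (simp add: square_weight_def prod_pos column_weight_pos)

lemma sum_square: "(\<Sum>p\<in>square l. F p) = (\<Sum>x=1..l. \<Sum>i=1..l. F (x, i))"
  by (simp add: square_def sum.cartesian_product)

text \<open>\<open>H_vert\<close> couples only sites with the same first coordinate, so the
  Boltzmann weight with fields is a product over columns; this is the independence of the
  columns.\<close>

lemma square_weight_exp:
  "square_weight lam l h \<sigma> = exp (- H_vert lam l \<sigma> + (\<Sum>(x, i)\<in>square l. h i * \<sigma> (x, i)))"
proof -
  have "column_weight lam l h (column l \<sigma> x) =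
      exp (\<Sum>i=1..l. lam * \<sigma> (x, i) * \<sigma> (x, next_site l i) + h i * \<sigma> (x, i))" for x
    unfolding column_weight_def using next_site_in[of _ l]
    by (intro arg_cong[where f=exp] sum.cong) (simp_all add: column_def)
  then have "square_weight lam l h \<sigma> =
      exp (\<Sum>x=1..l. \<Sum>i=1..l. lam * \<sigma> (x, i) * \<sigma> (x, next_site l i) + h i * \<sigma> (x, i))"
    by (simp add: square_weight_def exp_sum)
  then show ?thesis
    by (simp add: H_vert_def sum_square sum.distrib sum_distrib_left sum_negf mult.assoc)
qed

lemma Z_square_eq: "Z_square lam l h = (\<Sum>\<sigma>\<in>configs (square l). square_weight lam l h \<sigma>)"
  by (simp add: Z_square_def square_weight_exp)

lemma finite_square: "finite (square l)" and card_square: "card (square l) = l\<^sup>2"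
  by (simp_all add: square_def power2_eq_square)

lemma Z_square_power: "Z_square lam l h = Z_column lam l h ^ l"
proof -
  have "Z_square lam l h = (\<Sum>\<tau>\<in>{1..l} \<rightarrow>\<^sub>E configs {1..l}. \<Prod>x=1..l. column_weight lam l h (\<tau> x))"
    unfolding Z_square_eq by (subst sum_configs_square[symmetric]) (simp add: square_weight_def)
  also have "\<dots> = (\<Prod>x=1..l. \<Sum>c\<in>configs {1..l}. column_weight lam l h c)"
    by (rule prod_sum_PiE[symmetric]) (auto intro: finite_configs)
  finally show ?thesis by (simp add: Z_column_eq)
qed

text \<open>Row \<open>i\<close> meets each column once, so its error is a sum of \<open>l\<close>
  independent copies of \<open>c i - m i\<close>. Each is centred by the choice of \<open>h\<close>,
  with variance \<open>1 - (m i)\<^sup>2 \<le> 1\<close>.\<close>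

lemma square_row_variance:
  assumes "associated_fields lam l m h" "i \<in> {1..l}"
  shows "(\<Sum>\<sigma>\<in>configs (square l). square_weight lam l h \<sigma> * ((\<Sum>x=1..l. \<sigma> (x, i)) - real l * m i)\<^sup>2)
    \<le> real l * Z_square lam l h"
proof -
  define C where "C = configs {1..l}"
  define w where "w = column_weight lam l h"
  define g where "g = (\<lambda>c::nat \<Rightarrow> real. c i - m i)"
  have finC: "finite C" by (simp add: C_def finite_configs)
  have mean: "(\<Sum>c\<in>C. w c * g c) = 0"
    using assms by (simp add: associated_fields_iff C_def w_def g_def mult.commute)
  have Z: "Z_column lam l h = (\<Sum>c\<in>C. w c)" by (simp add: Z_column_eq C_def w_def)
  \<comment> \<open>Because spins square to 1, \<open>(g c)\<^sup>2\<close> is affine in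
    \<open>g c\<close>, and the linear part has mean zero.\<close>
  have "w c * (g c)\<^sup>2 = (1 - (m i)\<^sup>2) * w c - 2 * m i * (w c * g c)" if "c \<in> C" for c
  proof -
    have "c i * c i = 1" using that assms(2) configs_square[of c] by (simp add: C_def power2_eq_square)
    then have "(g c)\<^sup>2 = (1 - (m i)\<^sup>2) - 2 * m i * g c"
      by (simp add: g_def power2_eq_square algebra_simps)
    then show ?thesis by (simp only: right_diff_distrib mult_ac)
  qed
  then have "(\<Sum>c\<in>C. w c * (g c)\<^sup>2) = (1 - (m i)\<^sup>2) * (\<Sum>c\<in>C. w c) - 2 * m i * (\<Sum>c\<in>C. w c * g c)"
    by (simp add: sum_subtractf sum_distrib_left)
  also have "\<dots> \<le> Z_column lam l h"
    using mean Z_column_pos[of lam l h] by (simp add: Z[symmetric] mult_left_le_one_le left_diff_distrib)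
  finally have var: "(\<Sum>c\<in>C. w c * (g c)\<^sup>2) \<le> Z_column lam l h" .
  have l: "l > 0" using assms(2) by auto
  have "(\<Sum>\<sigma>\<in>configs (square l). square_weight lam l h \<sigma> * ((\<Sum>x=1..l. \<sigma> (x, i)) - real l * m i)\<^sup>2) =
     (\<Sum>\<tau>\<in>{1..l} \<rightarrow>\<^sub>E C. (\<Prod>x=1..l. w (\<tau> x)) * (\<Sum>x=1..l. g (\<tau> x))\<^sup>2)"
    unfolding C_def using assms(2)
    by (subst sum_configs_square[symmetric])
      (simp add: square_weight_def w_def g_def column_def sum_subtractf)
  also have "\<dots> = real l * (Z_column lam l h ^ (l - 1) * (\<Sum>c\<in>C. w c * (g c)\<^sup>2))"
    using product_weight_second_moment[OF _ finC mean, of "{1..l}"] by (simp add: Z)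
  also have "\<dots> \<le> real l * (Z_column lam l h ^ (l - 1) * Z_column lam l h)"
    using var Z_column_pos[of lam l h] by (intro mult_left_mono) auto
  also have "\<dots> = real l * Z_square lam l h"
    using l by (simp add: Z_square_power power_eq_if mult.commute)
  finally show ?thesis .
qed

lemma square_weight_ratio:
  assumes "lam \<ge> 0" "\<sigma> \<in> configs (square l)" "\<tau> \<in> configs (square l)" "\<And>i. i \<in> {1..l} \<Longrightarrow> \<bar>h i\<bar> \<le> B"
  shows "square_weight lam l h \<sigma> \<le>
    exp ((4 * lam + 2 * B) * real (card (discrepancy (square l) \<sigma> \<tau>))) * square_weight lam l h \<tau>"
proof -
  define d where "d = (\<lambda>x. card {i\<in>{1..l}. column l \<sigma> x i \<noteq> column l \<tau> x i})"
  have "discrepancy (square l) \<sigma> \<tau> = Sigma {1..l} (\<lambda>x. {i\<in>{1..l}. column l \<sigma> x i \<noteq> column l \<tau> x i})"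
    by (auto simp: discrepancy_def square_def column_def)
  then have card: "card (discrepancy (square l) \<sigma> \<tau>) = (\<Sum>x=1..l. d x)"
    by (simp add: d_def)
  have "square_weight lam l h \<sigma> \<le>
     (\<Prod>x=1..l. exp ((4 * lam + 2 * B) * real (d x)) * column_weight lam l h (column l \<tau> x))"
    unfolding square_weight_def d_def using assms
    by (intro prod_mono conjI column_weight_ratio column_in_configs less_imp_le[OF column_weight_pos])
  also have "\<dots> = exp (\<Sum>x=1..l. (4 * lam + 2 * B) * real (d x)) * square_weight lam l h \<tau>"
    by (simp add: prod.distrib exp_sum square_weight_def)
  also have "(\<Sum>x=1..l. (4 * lam + 2 * B) * real (d x)) = (4 * lam + 2 * B) * real (\<Sum>x=1..l. d x)"
    by (simp add: sum_distrib_left)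
  finally show ?thesis by (simp only: card)
qed

subsection \<open>The prescribed row sums\<close>

definition constrained :: "nat \<Rightarrow> (nat \<Rightarrow> real) \<Rightarrow> (nat \<times> nat \<Rightarrow> real) set" where
  "constrained l m = {\<sigma>\<in>configs (square l). \<forall>i\<in>{1..l}. (\<Sum>x=1..l. \<sigma> (x, i)) = real l * m i}"

lemma finite_constrained: "finite (constrained l m)"
  by (simp add: constrained_def finite_configs finite_square)

lemma phi_eq:
  "phi lam l m = - (1 / (real l)\<^sup>2) * ln (\<Sum>\<sigma>\<in>constrained l m. exp (- H_vert lam l \<sigma>))"
proof -
  have "(\<Sum>\<sigma>\<in>configs (square l). exp (- H_vert lam l \<sigma>) *
      of_bool (\<forall>i\<in>{1..l}. (\<Sum>x = 1..l. \<sigma> (x, i)) = real l * m i)) =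
    (\<Sum>\<sigma>\<in>constrained l m. exp (- H_vert lam l \<sigma>))"
    unfolding constrained_def
    by (rule sum.mono_neutral_cong_right) (auto simp: finite_configs finite_square)
  then show ?thesis by (simp only: phi_def card_square of_nat_power)
qed

text \<open>The field energy depends on the configuration only through its row sums, so it is
  constant under the constraint. Its value is what the prefactor
  \<open>exp (- real l * (\<Sum>i = 1..l. h i * m i))\<close> in the theorem cancels.\<close>

lemma sum_constrained_weight:
  "(\<Sum>\<sigma>\<in>constrained l m. square_weight lam l h \<sigma>) =
    exp (real l * (\<Sum>i=1..l. h i * m i)) * (\<Sum>\<sigma>\<in>constrained l m. exp (- H_vert lam l \<sigma>))"
proof -
  have "(\<Sum>(x, i)\<in>square l. h i * \<sigma> (x, i)) = real l * (\<Sum>i=1..l. h i * m i)"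
    if "\<sigma> \<in> constrained l m" for \<sigma>
  proof -
    have "(\<Sum>(x, i)\<in>square l. h i * \<sigma> (x, i)) = (\<Sum>i=1..l. \<Sum>x=1..l. h i * \<sigma> (x, i))"
      unfolding sum_square prod.case by (rule sum.swap)
    also have "\<dots> = (\<Sum>i=1..l. h i * (real l * m i))"
      using that by (intro sum.cong refl) (simp add: constrained_def flip: sum_distrib_left)
    finally show ?thesis by (simp add: sum_distrib_left mult_ac)
  qed
  then have "square_weight lam l h \<sigma> = exp (real l * (\<Sum>i=1..l. h i * m i)) * exp (- H_vert lam l \<sigma>)"
    if "\<sigma> \<in> constrained l m" for \<sigma>
    using that by (simp only: square_weight_exp exp_add mult.commute)
  then show ?thesis by (simp only: sum_distrib_left cong: sum.cong)
qed

text \<open>Rows are disjoint, so each is repaired separately and the flips add up. Membership in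
  \<open>magnetizations l\<close> makes \<open>l * m i\<close> an attainable row sum.\<close>

lemma near_constrained:
  assumes s: "\<sigma> \<in> configs (square l)" and m: "\<And>i. i \<in> {1..l} \<Longrightarrow> m i \<in> magnetizations l"
  shows "\<exists>\<tau>\<in>constrained l m. 2 * real (card (discrepancy (square l) \<sigma> \<tau>)) =
    (\<Sum>i=1..l. \<bar>(\<Sum>x=1..l. \<sigma> (x, i)) - real l * m i\<bar>)"
proof -
  have "\<forall>i\<in>{1..l}. \<exists>g. (\<forall>x. g x \<in> {-1, 1}) \<and> (\<Sum>x=1..l. g x) = real l * m i \<and>
     2 * real (card {x\<in>{1..l}. \<sigma> (x, i) \<noteq> g x}) = \<bar>(\<Sum>x=1..l. \<sigma> (x, i)) - real l * m i\<bar>"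
  proof
    fix i assume i: "i \<in> {1..l}"
    obtain k where k: "k \<le> l" "m i = -1 + 2 * real k / real l"
      using m[OF i] by (auto simp: magnetizations_def)
    then have "real l * m i = 2 * real k - real (card {1..l})"
      using i by (auto simp: field_simps)
    moreover have "\<sigma> (x, i) = -1 \<or> \<sigma> (x, i) = 1" if "x \<in> {1..l}" for x
      using configs_apply[OF s] that i by (auto simp: square_def)
    ultimately show "\<exists>g. (\<forall>x. g x \<in> {-1, 1}) \<and> (\<Sum>x=1..l. g x) = real l * m i \<and>
        2 * real (card {x\<in>{1..l}. \<sigma> (x, i) \<noteq> g x}) = \<bar>(\<Sum>x=1..l. \<sigma> (x, i)) - real l * m i\<bar>"
      using adjust_row_sum[of "{1..l}" "\<lambda>x. \<sigma> (x, i)" k] k by simp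
  qed
  from bchoice[OF this] obtain g where g: "\<And>i x. i \<in> {1..l} \<Longrightarrow> g i x \<in> {-1, 1 :: real}"
    "\<And>i. i \<in> {1..l} \<Longrightarrow> (\<Sum>x=1..l. g i x) = real l * m i"
    "\<And>i. i \<in> {1..l} \<Longrightarrow> 2 * real (card {x\<in>{1..l}. \<sigma> (x, i) \<noteq> g i x}) = \<bar>(\<Sum>x=1..l. \<sigma> (x, i)) - real l * m i\<bar>"
    by blast
  define \<tau> where "\<tau> = (\<lambda>(x, i)\<in>square l. g i x)"
  have \<tau>: "\<tau> (x, i) = g i x" if "x \<in> {1..l}" "i \<in> {1..l}" for x i
    using that by (simp add: \<tau>_def square_def)
  have "\<tau> \<in> configs (square l)"
    using g(1) by (force simp: \<tau>_def configs_def square_def)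
  then have "\<tau> \<in> constrained l m"
    using g(2) \<tau> by (simp add: constrained_def)
  moreover have "card (discrepancy (square l) \<sigma> \<tau>) = (\<Sum>i=1..l. card {x\<in>{1..l}. \<sigma> (x, i) \<noteq> g i x})"
  proof -
    have "discrepancy (square l) \<sigma> \<tau> =
        prod.swap ` Sigma {1..l} (\<lambda>i. {x\<in>{1..l}. \<sigma> (x, i) \<noteq> g i x})"
      using \<tau> by (force simp: discrepancy_def square_def image_iff)
    then show ?thesis by (simp add: card_image)
  qed
  ultimately show ?thesis
    using g(3) by (intro bexI[of _ \<tau>]) (simp_all add: sum_distrib_left)
qed

lemma sum_constrained_le: "(\<Sum>\<sigma>\<in>constrained l m. square_weight lam l h \<sigma>) \<le> Z_square lam l h"
  unfolding Z_square_eq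
  by (rule sum_mono2) (auto simp: finite_configs finite_square constrained_def square_weight_pos less_imp_le)

text \<open>By Markov's inequality half of the weight lies on configurations whose squared row errors add
  up to at most \<open>2 * l\<^sup>2\<close>; by Cauchy-Schwarz these are within \<open>l * sqrt l\<close> flips of the constraint.\<close>

lemma Z_square_le_constrained:
  assumes lam: "lam \<ge> 0" and h: "associated_fields lam l m h" and l: "l \<ge> 1"
    and m: "\<And>i. i \<in> {1..l} \<Longrightarrow> m i \<in> magnetizations l"
    and B: "\<And>i. i \<in> {1..l} \<Longrightarrow> \<bar>h i\<bar> \<le> B"
  defines "K \<equiv> nat \<lfloor>real l * sqrt (real l)\<rfloor>"
  shows "Z_square lam l h \<le> 2 * (real ((l\<^sup>2 + 1) ^ K) *
    (exp ((4 * lam + 2 * B) * real K) * (\<Sum>\<sigma>\<in>constrained l m. square_weight lam l h \<sigma>)))"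
proof -
  define C where "C = configs (square l)"
  define w where "w = square_weight lam l h"
  define e where "e = (\<lambda>\<sigma> i. (\<Sum>x=1..l. \<sigma> (x, i)) - real l * m i :: real)"
  define Q where "Q = (\<lambda>\<sigma>::nat \<times> nat \<Rightarrow> real. \<Sum>i=1..l. (e \<sigma> i)\<^sup>2)"
  define S where "S = {\<sigma>\<in>C. Q \<sigma> \<le> 2 * (real l)\<^sup>2}"
  have finC: "finite C" by (simp add: C_def finite_configs finite_square)
  have wpos: "w \<sigma> > 0" for \<sigma> by (simp add: w_def square_weight_pos)
  have Q0: "Q \<sigma> \<ge> 0" for \<sigma> by (simp add: Q_def sum_nonneg)
  have ZC: "Z_square lam l h = (\<Sum>\<sigma>\<in>C. w \<sigma>)" by (simp add: Z_square_eq C_def w_def)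
  have lpos: "(real l)\<^sup>2 > 0" using l by simp
  have B0: "B \<ge> 0" using B[of 1] l by auto
  have "(\<Sum>\<sigma>\<in>C. w \<sigma> * Q \<sigma>) = (\<Sum>i=1..l. \<Sum>\<sigma>\<in>C. w \<sigma> * (e \<sigma> i)\<^sup>2)"
    unfolding Q_def sum_distrib_left by (rule sum.swap)
  also have "\<dots> \<le> (\<Sum>i=1..l. real l * Z_square lam l h)"
    unfolding C_def w_def e_def by (intro sum_mono square_row_variance h)
  finally have second: "(\<Sum>\<sigma>\<in>C. w \<sigma> * Q \<sigma>) \<le> (real l)\<^sup>2 * Z_square lam l h"
    by (simp add: power2_eq_square)
  have "2 * (real l)\<^sup>2 * (\<Sum>\<sigma>\<in>C - S. w \<sigma>) \<le> (\<Sum>\<sigma>\<in>C - S. w \<sigma> * Q \<sigma>)"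
    unfolding sum_distrib_left
  proof (rule sum_mono)
    fix \<sigma> assume "\<sigma> \<in> C - S"
    then have "2 * (real l)\<^sup>2 \<le> Q \<sigma>" by (auto simp: S_def)
    then show "2 * (real l)\<^sup>2 * w \<sigma> \<le> w \<sigma> * Q \<sigma>"
      using wpos[of \<sigma>] by (simp add: mult.commute)
  qed
  also have "\<dots> \<le> (\<Sum>\<sigma>\<in>C. w \<sigma> * Q \<sigma>)"
    using finC by (intro sum_mono2) (auto intro!: mult_nonneg_nonneg[OF less_imp_le[OF wpos] Q0])
  finally have "(real l)\<^sup>2 * (2 * (\<Sum>\<sigma>\<in>C - S. w \<sigma>)) \<le> (real l)\<^sup>2 * Z_square lam l h"
    using second by simp
  then have "2 * (\<Sum>\<sigma>\<in>C - S. w \<sigma>) \<le> Z_square lam l h"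
    using lpos by (simp only: mult_le_cancel_left_pos)
  moreover have "(\<Sum>\<sigma>\<in>C. w \<sigma>) = (\<Sum>\<sigma>\<in>C - S. w \<sigma>) + (\<Sum>\<sigma>\<in>S. w \<sigma>)"
    using finC by (intro sum.subset_diff) (auto simp: S_def)
  ultimately have half: "Z_square lam l h \<le> 2 * (\<Sum>\<sigma>\<in>S. w \<sigma>)" using ZC by simp
  have "(\<Sum>\<sigma>\<in>S. w \<sigma>) \<le> real ((l\<^sup>2 + 1) ^ K) * (exp ((4 * lam + 2 * B) * real K) * (\<Sum>\<tau>\<in>constrained l m. w \<tau>))"
  proof (rule sum_le_sum_of_related[where R = "\<lambda>\<sigma> \<tau>. card (discrepancy (square l) \<sigma> \<tau>) \<le> K"])
    show "finite S" using finC by (simp add: S_def)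
    show "finite (constrained l m)" by (rule finite_constrained)
    show "w \<tau> \<ge> 0" for \<tau> using wpos[of \<tau>] by simp
    show "\<exists>\<tau>\<in>constrained l m. card (discrepancy (square l) \<sigma> \<tau>) \<le> K" if s: "\<sigma> \<in> S" for \<sigma>
    proof -
      obtain \<tau> where t: "\<tau> \<in> constrained l m"
        "2 * real (card (discrepancy (square l) \<sigma> \<tau>)) = (\<Sum>i=1..l. \<bar>e \<sigma> i\<bar>)"
        using near_constrained[of \<sigma> l m] s m by (auto simp: S_def C_def e_def)
      define d where "d = real (card (discrepancy (square l) \<sigma> \<tau>))"
      have "(2 * d)\<^sup>2 \<le> (\<Sum>i=1..l. \<bar>e \<sigma> i\<bar>\<^sup>2) * real (card {1..l})"
        unfolding d_def t(2) by (rule sum_squared_le_sum_of_squares)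
      also have "\<dots> = Q \<sigma> * real l" by (simp add: Q_def)
      also have "\<dots> \<le> 2 * (real l)\<^sup>2 * real l"
        using s by (intro mult_right_mono) (auto simp: S_def)
      finally have "4 * d\<^sup>2 \<le> 2 * ((real l)\<^sup>2 * real l)"
        by (simp add: power_mult_distrib mult_ac)
      \<comment> \<open>A factor 2 is given away here to keep \<open>K\<close> free of
        constants.\<close>
      then have "d\<^sup>2 \<le> (real l)\<^sup>2 * real l" using zero_le_power2[of d] by linarith
      also have "\<dots> = (real l * sqrt (real l))\<^sup>2" by (simp add: power_mult_distrib)
      finally have "d \<le> real l * sqrt (real l)"
        by (rule power2_le_imp_le) simp
      then have "card (discrepancy (square l) \<sigma> \<tau>) \<le> K"
        by (simp add: K_def d_def le_nat_floor)
      then show ?thesis using t(1) by blast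
    qed
    show "w \<sigma> \<le> exp ((4 * lam + 2 * B) * real K) * w \<tau>"
      if "\<sigma> \<in> S" "\<tau> \<in> constrained l m" and K: "card (discrepancy (square l) \<sigma> \<tau>) \<le> K" for \<sigma> \<tau>
    proof -
      have "w \<sigma> \<le> exp ((4 * lam + 2 * B) * real (card (discrepancy (square l) \<sigma> \<tau>))) * w \<tau>"
        unfolding w_def using that lam B
        by (intro square_weight_ratio) (auto simp: S_def C_def constrained_def)
      also have "\<dots> \<le> exp ((4 * lam + 2 * B) * real K) * w \<tau>"
        using K lam B0 wpos[of \<tau>] by (intro mult_right_mono) (auto intro!: mult_left_mono)
      finally show ?thesis .
    qed
    show "real (card {\<sigma>\<in>S. card (discrepancy (square l) \<sigma> \<tau>) \<le> K}) \<le> real ((l\<^sup>2 + 1) ^ K)"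
      if "\<tau> \<in> constrained l m" for \<tau>
    proof -
      have "card {\<sigma>\<in>S. card (discrepancy (square l) \<sigma> \<tau>) \<le> K} \<le>
          card {\<sigma>\<in>C. card (discrepancy (square l) \<sigma> \<tau>) \<le> K}"
        using finC by (intro card_mono) (auto simp: S_def)
      also have "\<dots> \<le> (l\<^sup>2 + 1) ^ K"
        using card_hamming_ball[of "square l" \<tau> K] that
        by (simp add: C_def card_square finite_square constrained_def)
      finally show ?thesis by (simp only: of_nat_le_iff)
    qed
  qed simp
  then show ?thesis using half by (simp add: w_def)
qed

text \<open>With \<open>e = a - 1/2\<close>, the logarithm is at most a multiple of
  \<open>l powr e\<close>, and \<open>3/2 + e = (a - 1) + 2\<close>. In the constant, one unit pays
  for the leading \<open>ln 2\<close>, one for the \<open>ln 2\<close> in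
  \<open>ln (2 * l\<^sup>2)\<close>, and \<open>2 / e\<close> for \<open>2 * ln l\<close>. Here
  \<open>B\<close> is the price per flip, later \<open>4 * lam + 2 * B\<close> with the field bound
  \<open>B\<close>.\<close>

lemma flip_cost_bound:
  assumes l: "l \<ge> 1" and a: "1 / 2 < a" and B: "B \<ge> 0"
  defines "K \<equiv> nat \<lfloor>real l * sqrt (real l)\<rfloor>"
  shows "(ln 2 + real K * (ln (real (l\<^sup>2 + 1)) + B)) / (real l)\<^sup>2 \<le> (2 + B + 2 / (a - 1 / 2)) * real l powr (a - 1)"
proof -
  define e where "e = a - 1 / 2"
  define L where "L = real l"
  have e: "e > 0" and L: "L \<ge> 1" using a l by (auto simp: e_def L_def)
  have p1: "L powr e \<ge> 1" using L e by (simp add: ge_one_powr_ge_zero)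
  have "real (l\<^sup>2 + 1) \<le> 2 * L\<^sup>2"
    using L by (simp add: L_def)
  then have "ln (real (l\<^sup>2 + 1)) \<le> ln (2 * L\<^sup>2)"
    using L by (subst ln_le_cancel_iff) (auto intro: add_pos_nonneg)
  also have "\<dots> = ln 2 + 2 * ln L" using L by (simp add: ln_mult ln_realpow)
  also have "\<dots> \<le> 1 + 2 * (L powr e / e)"
    using ln_powr_bound[OF L e] ln_2_less_1 by linarith
  also have "\<dots> \<le> L powr e + 2 / e * L powr e" using p1 by simp
  finally have lnb: "ln (real (l\<^sup>2 + 1)) \<le> (1 + 2 / e) * L powr e" by (simp add: algebra_simps)
  have "ln (real (l\<^sup>2 + 1)) \<ge> 0" by simp
  have "B * 1 \<le> B * L powr e" using p1 B by (intro mult_left_mono)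
  then have cost: "ln (real (l\<^sup>2 + 1)) + B \<le> (1 + B + 2 / e) * L powr e"
    using lnb by (simp add: algebra_simps)
  have Kle: "real K \<le> L * sqrt L" by (simp add: K_def L_def)
  have Ls: "1 \<le> L * sqrt L" using mult_mono[of 1 L 1 "sqrt L"] L by simp
  have "ln 2 + real K * (ln (real (l\<^sup>2 + 1)) + B) \<le> L * sqrt L * L powr e + L * sqrt L * ((1 + B + 2 / e) * L powr e)"
  proof (rule add_mono)
    show "ln 2 \<le> L * sqrt L * L powr e"
      using mult_mono[OF Ls p1] ln_2_less_1 L by simp
    show "real K * (ln (real (l\<^sup>2 + 1)) + B) \<le> L * sqrt L * ((1 + B + 2 / e) * L powr e)"
      using Kle cost B \<open>ln (real (l\<^sup>2 + 1)) \<ge> 0\<close> L by (intro mult_mono) auto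
  qed
  also have "\<dots> = (2 + B + 2 / e) * (L * sqrt L * L powr e)" by (simp add: algebra_simps)
  also have "L * sqrt L * L powr e = L powr (a - 1) * L\<^sup>2"
  proof -
    have "L * sqrt L * L powr e = L powr (1 + 1 / 2 + e)"
      using L by (simp only: powr_add powr_half_sqrt) simp
    also have "\<dots> = L powr ((a - 1) + 2)" by (simp add: e_def)
    also have "\<dots> = L powr (a - 1) * L\<^sup>2" using L by (simp only: powr_add) (simp add: powr_numeral)
    finally show ?thesis .
  qed
  finally show ?thesis
    using L by (simp add: L_def[symmetric] e_def[symmetric] divide_le_eq mult.assoc)
qed

text \<open>Writing \<open>W\<close> for the constrained part of \<open>Z\<close>, the terms
  \<open>s\<close> cancel and the quantity becomes \<open>(ln Z - ln W) / l\<^sup>2\<close>. It is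
  nonnegative because \<open>W\<close> is a part of \<open>Z\<close>, and bounded above by the cost
  of the repairs.\<close>

lemma free_energy_estimate:
  assumes lam: "lam \<ge> 0" and h: "associated_fields lam l m h" and l: "l \<ge> 1" and a: "1 / 2 < a"
    and m: "\<And>i. i \<in> {1..l} \<Longrightarrow> m i \<in> magnetizations l"
    and B: "\<And>i. i \<in> {1..l} \<Longrightarrow> \<bar>h i\<bar> \<le> B"
  shows "\<bar>1 / (real l)\<^sup>2 * ln (exp (- real l * (\<Sum>i = 1..l. h i * m i)) * Z_square lam l h) + phi lam l m\<bar>
    \<le> (2 + (4 * lam + 2 * B) + 2 / (a - 1 / 2)) * real l powr (a - 1)"
proof -
  define K where "K = nat \<lfloor>real l * sqrt (real l)\<rfloor>"
  define W where "W = (\<Sum>\<sigma>\<in>constrained l m. square_weight lam l h \<sigma>)"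
  define N where "N = (\<Sum>\<sigma>\<in>constrained l m. exp (- H_vert lam l \<sigma>))"
  define Z where "Z = Z_square lam l h"
  define s where "s = real l * (\<Sum>i = 1..l. h i * m i)"
  have B0: "B \<ge> 0" using B[of 1] l by auto
  have Zpos: "Z > 0" by (simp add: Z_def Z_square_power Z_column_pos)
  have WN: "W = exp s * N" by (simp add: W_def N_def s_def sum_constrained_weight)
  have ZW: "Z \<le> 2 * (real ((l\<^sup>2 + 1) ^ K) * (exp ((4 * lam + 2 * B) * real K) * W))"
    unfolding Z_def K_def W_def by (rule Z_square_le_constrained[OF lam h l m B])
  \<comment> \<open>Positivity, needed for the logarithms, is read off the comparison itself: a
    nonnegative multiple of \<open>W\<close> dominates \<open>Z > 0\<close>, so no admissible
    configuration has to be exhibited.\<close>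
  have Wpos: "W > 0"
  proof (rule ccontr)
    assume "\<not> W > 0"
    then have "2 * (real ((l\<^sup>2 + 1) ^ K) * (exp ((4 * lam + 2 * B) * real K) * W)) \<le> 0"
      by (intro mult_nonneg_nonpos) auto
    then show False using ZW Zpos by linarith
  qed
  then have Npos: "N > 0" using WN by (simp add: zero_less_mult_iff)
  have "ln Z \<le> ln (2 * (real ((l\<^sup>2 + 1) ^ K) * (exp ((4 * lam + 2 * B) * real K) * W)))"
    using ZW Zpos by simp
  also have "\<dots> = ln 2 + (real K * ln (real (l\<^sup>2 + 1)) + ((4 * lam + 2 * B) * real K + ln W))"
  proof -
    have p: "real ((l\<^sup>2 + 1) ^ K) > 0" by (simp only: of_nat_0_less_iff zero_less_power)
    have "ln (real ((l\<^sup>2 + 1) ^ K)) = real K * ln (real (l\<^sup>2 + 1))"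
      unfolding of_nat_power by (rule ln_realpow)
    then show ?thesis using p Wpos by (simp only: ln_mult_pos mult_pos_pos exp_gt_zero zero_less_numeral ln_exp)
  qed
  finally have upper: "ln Z - ln W \<le> ln 2 + real K * (ln (real (l\<^sup>2 + 1)) + (4 * lam + 2 * B))"
    by (simp add: algebra_simps)
  have "W \<le> Z" unfolding W_def Z_def by (rule sum_constrained_le)
  then have lower: "ln Z - ln W \<ge> 0" using Wpos by simp
  have lnW: "ln W = s + ln N" using Npos by (simp add: WN ln_mult_pos)
  have "ln (exp (- s) * Z) = - s + ln Z" using Zpos by (simp add: ln_mult_pos)
  then have "1 / (real l)\<^sup>2 * ln (exp (- s) * Z) + phi lam l m = 1 / (real l)\<^sup>2 * (- s + ln Z) - 1 / (real l)\<^sup>2 * ln N"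
    by (simp add: phi_eq N_def)
  also have "\<dots> = (ln Z - ln W) / (real l)\<^sup>2" by (simp add: lnW diff_divide_distrib add_divide_distrib)
  finally have eq: "1 / (real l)\<^sup>2 * ln (exp (- s) * Z) + phi lam l m = (ln Z - ln W) / (real l)\<^sup>2" .
  have "\<bar>(ln Z - ln W) / (real l)\<^sup>2\<bar> = (ln Z - ln W) / (real l)\<^sup>2"
    using lower by simp
  also have "\<dots> \<le> (ln 2 + real K * (ln (real (l\<^sup>2 + 1)) + (4 * lam + 2 * B))) / (real l)\<^sup>2"
    using upper by (intro divide_right_mono) auto
  also have "\<dots> \<le> (2 + (4 * lam + 2 * B) + 2 / (a - 1 / 2)) * real l powr (a - 1)"
    unfolding K_def using lam B0 by (intro flip_cost_bound l a) auto
  finally show ?thesis unfolding eq[symmetric] by (simp add: s_def Z_def)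
qed

theorem theorem6:
  fixes h_star m_star m_plus :: real
  assumes "h_star > 3" and "3 / (cosh (h_star - 3))\<^sup>2 = 1 / 4"
    and "0 < m_star" and "m_star < 1" and "artanh m_star - m_star = h_star"
    and "m_star < m_plus" and "m_plus < 1"
  shows "\<exists>lam0::real. lam0 > 0 \<and>
    (\<forall>lam. 0 < lam \<and> lam \<le> lam0 \<longrightarrow>
      (\<forall>a. 1 / 2 < a \<and> a < 1 \<longrightarrow>
        (\<exists>c::real. \<forall>l::nat. \<forall>m::nat \<Rightarrow> real.
           l \<ge> 3 \<and> (\<forall>i\<in>{1..l}. m i \<in> magnetizations l \<and> \<bar>m i\<bar> \<le> m_plus) \<longrightarrow>
           (\<exists>!h. associated_fields lam l m h) \<and>
           (\<forall>h. associated_fields lam l m h \<longrightarrow>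
             \<bar>1 / (real l)\<^sup>2 * ln (exp (- real l * (\<Sum>i = 1..l. h i * m i)) * Z_square lam l h)
               + phi lam l m\<bar> \<le> c * real l powr (a - 1)))))"
proof (rule exI[of _ 1], intro conjI allI impI)
  \<comment> \<open>Existence, uniqueness and the estimate are available for each nonnegative
    coupling, with a constant depending on it; the value 1 for \<open>lam0\<close> is an arbitrary
    choice.\<close>
  fix lam a :: real
  assume lam: "0 < lam \<and> lam \<le> 1" and a: "1 / 2 < a \<and> a < 1"
  \<comment> \<open>The field bound at \<open>M = m_plus\<close> involves neither \<open>l\<close>
    nor \<open>m\<close>, so the constant built from it depends only on \<open>lam\<close>,
    \<open>a\<close> and \<open>m_plus\<close>.\<close>
  define B where "B = 2 * lam + ln (2 / (1 - m_plus)) / 2"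
  show "\<exists>c::real. \<forall>l::nat. \<forall>m::nat \<Rightarrow> real.
           l \<ge> 3 \<and> (\<forall>i\<in>{1..l}. m i \<in> magnetizations l \<and> \<bar>m i\<bar> \<le> m_plus) \<longrightarrow>
           (\<exists>!h. associated_fields lam l m h) \<and>
           (\<forall>h. associated_fields lam l m h \<longrightarrow>
             \<bar>1 / (real l)\<^sup>2 * ln (exp (- real l * (\<Sum>i = 1..l. h i * m i)) * Z_square lam l h)
               + phi lam l m\<bar> \<le> c * real l powr (a - 1))"
  proof (rule exI[of _ "2 + (4 * lam + 2 * B) + 2 / (a - 1 / 2)"], intro allI impI conjI)
    fix l :: nat and m :: "nat \<Rightarrow> real"
    assume "l \<ge> 3 \<and> (\<forall>i\<in>{1..l}. m i \<in> magnetizations l \<and> \<bar>m i\<bar> \<le> m_plus)"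
    then have l: "l \<ge> 1" and m: "\<And>i. i \<in> {1..l} \<Longrightarrow> m i \<in> magnetizations l"
      and mb: "\<And>i. i \<in> {1..l} \<Longrightarrow> \<bar>m i\<bar> \<le> m_plus" by auto
    have lam0: "lam \<ge> 0" using lam by simp
    show "\<exists>!h. associated_fields lam l m h"
      using associated_fields_exist[OF lam0 \<open>m_plus < 1\<close>, of l m] mb associated_fields_unique by blast
    fix h assume h: "associated_fields lam l m h"
    have "\<bar>h i\<bar> \<le> B" if "i \<in> {1..l}" for i
      unfolding B_def by (rule associated_fields_bound[OF lam0 \<open>m_plus < 1\<close> h that mb[OF that]])
    then show "\<bar>1 / (real l)\<^sup>2 * ln (exp (- real l * (\<Sum>i = 1..l. h i * m i)) * Z_square lam l h)
        + phi lam l m\<bar> \<le> (2 + (4 * lam + 2 * B) + 2 / (a - 1 / 2)) * real l powr (a - 1)"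
      using a m by (intro free_energy_estimate lam0 h l) auto
  qed
qed simp

end
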